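(* Let $m\geq 2$ and let $f:\mathbb{R}^m\to\mathbb{R}^m$ be a homeomorphism with the topological shadowing property. If $K\subset\mathbb{R}^m$ is a compact global attractor for $f$, then $K$ is trivial, i.e. $K=\{p\}$ for some $p\in\mathbb{R}^m$.
   Context: $d$ denotes the Euclidean distance on $\mathbb{R}^m$, and $C^+(\mathbb{R}^m)$ is the set of continuous functions $\mathbb{R}^m\to(0,+\infty)$. Topological shadowing property: for $\delta\in C^+(\mathbb{R}^m)$, a $\delta$-pseudo orbit of $f$ is a sequence $\{x_n\}_{n\in\mathbb{Z}}$ in $\mathbb{R}^m$ with $d(f(x_n),x_{n+1})<\delta(f(x_n))$ for all $n\in\mathbb{Z}$. For $\epsilon\in C^+(\mathbb{R}^m)$, the sequence is $\epsilon$-shadowed by (the orbit of) $y\in\mathbb{R}^m$ if $d(f^n(y),x_n)<\epsilon(x_n)$ for all $n\in\mathbb{Z}$. The homeomorphism $f$ has the topological shadowing property if for every $\epsilon\in C^+(\mathbb{R}^m)$ there is $\delta\in C^+(\mathbb{R}^m)$ such that every $\delta$-pseudo orbit is $\epsilon$-shadowed by some point of $\mathbb{R}^m$. Global attractor: a compact set $K\subset\mathbb{R}^m$ is an attractor for $f$ if there is a bounded open neighborhood $U$ of $K$ with $\overline{f(U)}\subset U$ and $K=\bigcap_{n>0}f^n(U)$. It is a global attractor if moreover $\bigcup_{n\geq 0}f^{-n}(U)=\mathbb{R}^m$. *)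

theory Defs
  imports "HOL-Analysis.Analysis"
begin

definition pos_continuous :: "('a::topological_space \<Rightarrow> real) set" where
  "pos_continuous = {\<delta>. continuous_on UNIV \<delta> \<and> (\<forall>x. 0 < \<delta> x)}"

(* Only meaningful for a bijection f: negative powers iterate inv f. *)
definition int_iterate :: "('a \<Rightarrow> 'a) \<Rightarrow> int \<Rightarrow> 'a \<Rightarrow> 'a" where
  "int_iterate f n = (if 0 \<le> n then f ^^ nat n else inv f ^^ nat (- n))"

definition pseudo_orbit ::
    "('a::metric_space \<Rightarrow> real) \<Rightarrow> ('a \<Rightarrow> 'a) \<Rightarrow> (int \<Rightarrow> 'a) \<Rightarrow> bool" where
  "pseudo_orbit \<delta> f x \<longleftrightarrow> (\<forall>n. dist (f (x n)) (x (n + 1)) < \<delta> (f (x n)))"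

definition shadowed_by ::
    "('a::metric_space \<Rightarrow> real) \<Rightarrow> ('a \<Rightarrow> 'a) \<Rightarrow> (int \<Rightarrow> 'a) \<Rightarrow> 'a \<Rightarrow> bool" where
  "shadowed_by \<epsilon> f x y \<longleftrightarrow> (\<forall>n. dist (int_iterate f n y) (x n) < \<epsilon> (x n))"

definition topological_shadowing :: "('a::metric_space \<Rightarrow> 'a) \<Rightarrow> bool" where
  "topological_shadowing f \<longleftrightarrow>
     (\<forall>\<epsilon>\<in>pos_continuous. \<exists>\<delta>\<in>pos_continuous.
        \<forall>x. pseudo_orbit \<delta> f x \<longrightarrow> (\<exists>y. shadowed_by \<epsilon> f x y))"

definition attracting_nbhd ::
    "('a::metric_space \<Rightarrow> 'a) \<Rightarrow> 'a set \<Rightarrow> 'a set \<Rightarrow> bool" where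
  "attracting_nbhd f K U \<longleftrightarrow>
     open U \<and> bounded U \<and> K \<subseteq> U \<and> closure (f ` U) \<subseteq> U \<and> K = (\<Inter>n\<in>{0<..}. (f ^^ n) ` U)"

(* The neighbourhood whose preimages cover the space is the one witnessing
   that K is an attractor; (f ^^ n) -` U is f^{-n}(U). *)
definition global_attractor :: "('a::metric_space \<Rightarrow> 'a) \<Rightarrow> 'a set \<Rightarrow> bool" where
  "global_attractor f K \<longleftrightarrow>
     compact K \<and> (\<exists>U. attracting_nbhd f K U \<and> (\<Union>n. (f ^^ n) -` U) = UNIV)"

end

theory Submission
  imports Defs "HOL-Complex_Analysis.Great_Picard"
begin

text \<open>Let \<open>S\<close> be a sphere around the attracting neighbourhood \<open>U\<close>. Its backward images escape to
  infinity, so for a tolerance decaying fast enough a pseudo orbit that is exact up to a point \<open>z\<close> of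
  \<open>S\<close> can only be shadowed by \<open>z\<close> itself: every pseudo orbit issuing from \<open>z\<close> stays close to the orbit
  of \<open>z\<close>. Hence the iterates of \<open>f\<close> are equicontinuous on \<open>S\<close>, and by Arzela--Ascoli some power of \<open>f\<close>
  is nearly the identity on some \<open>f\<^sup>n(S)\<close>. As \<open>S\<close> is connected (here \<open>m \<ge> 2\<close> enters), pseudo orbits
  can drift between any two points of \<open>f\<^sup>n(S)\<close>, which therefore has small diameter. But \<open>f\<^sup>n(S)\<close>
  bounds the image of a ball containing \<open>K\<close>.\<close>

section \<open>Preliminaries on moduli of continuity, tolerances and frontiers\<close>

lemma uniform_modulus_compact:
  fixes h :: "'a::euclidean_space \<Rightarrow> 'b::metric_space"
  assumes "continuous_on UNIV h" "compact C" "0 < e"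
  obtains \<eta> where "0 < \<eta>" "\<And>x y. x \<in> C \<Longrightarrow> dist y x < \<eta> \<Longrightarrow> dist (h y) (h x) < e"
proof -
  obtain R where R: "\<And>x. x \<in> C \<Longrightarrow> norm x \<le> R"
    using compact_imp_bounded[OF assms(2)] bounded_iff by metis
  have "uniformly_continuous_on (cball 0 (R + 1)) h"
    using assms(1) by (meson compact_cball compact_uniformly_continuous continuous_on_subset subset_UNIV)
  then obtain d where d: "0 < d"
    "\<And>x y. x \<in> cball 0 (R + 1) \<Longrightarrow> y \<in> cball 0 (R + 1) \<Longrightarrow> dist y x < d \<Longrightarrow> dist (h y) (h x) < e"
    using assms(3) unfolding uniformly_continuous_on_def by metis
  show thesis
  proof
    \<comment> \<open>Truncating at 1 keeps \<open>y\<close>, which need not lie in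
      \<open>C\<close>, inside the larger ball on which \<open>h\<close> is uniformly
      continuous.\<close>
    show "0 < min d 1" using d by simp
    fix x y assume xy: "x \<in> C" "dist y x < min d 1"
    have "norm x \<le> R" using R xy by auto
    moreover have "norm y \<le> norm x + dist y x"
      by (metis add.commute dist_0_norm dist_commute dist_triangle)
    ultimately show "dist (h y) (h x) < e"
      using xy by (intro d(2)) (auto)
  qed
qed

text \<open>The infimum over \<open>n\<close> of \<open>\<eta> n + infdist x (C n)\<close> works: it
  is 1-Lipschitz, like each of its terms, and at each point all but finitely many terms exceed 1, so
  it stays positive.\<close>

lemma pos_continuous_locally_finite:
  fixes C :: "nat \<Rightarrow> 'a::metric_space set"
  assumes pos: "\<And>n. 0 < \<eta> n" and ne: "\<And>n. C n \<noteq> {}"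
    and lf: "\<And>x. \<exists>N. \<forall>n\<ge>N. C n \<inter> ball x 1 = {}"
  obtains \<epsilon> where "\<epsilon> \<in> pos_continuous" "\<And>n x. x \<in> C n \<Longrightarrow> \<epsilon> x \<le> \<eta> n"
proof -
  define \<epsilon> where "\<epsilon> = (\<lambda>x. INF n. \<eta> n + infdist x (C n))"
  have bdd: "bdd_below (range (\<lambda>n. \<eta> n + infdist x (C n)))" for x
    by (rule bdd_belowI2[where m = 0]) (use pos in \<open>auto intro!: add_nonneg_nonneg infdist_nonneg simp: less_imp_le\<close>)
  have lip: "\<epsilon> x \<le> \<epsilon> y + dist x y" for x y
  proof -
    have "\<epsilon> x - dist x y \<le> \<epsilon> y"
      unfolding \<epsilon>_def
    proof (rule cINF_greatest)
      fix n
      have "(INF n. \<eta> n + infdist x (C n)) \<le> \<eta> n + infdist x (C n)"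
        by (rule cINF_lower[OF bdd]) simp
      then show "(INF n. \<eta> n + infdist x (C n)) - dist x y \<le> \<eta> n + infdist y (C n)"
        using infdist_triangle[of x "C n" y] by linarith
    qed simp
    then show ?thesis by simp
  qed
  have "dist (\<epsilon> x) (\<epsilon> y) \<le> dist x y" for x y
    using lip[of x y] lip[of y x] by (simp add: dist_real_def dist_commute abs_le_iff)
  then have cont: "continuous_on UNIV \<epsilon>"
    unfolding continuous_on_iff by (meson le_less_trans dist_commute)
  have "0 < \<epsilon> x" for x
  proof -
    obtain N where N: "\<And>n. n \<ge> N \<Longrightarrow> C n \<inter> ball x 1 = {}" using lf by blast
    define m where "m = Min (insert 1 (\<eta> ` {..<N}))"
    have m: "0 < m" "m \<le> 1" "\<And>n. n < N \<Longrightarrow> m \<le> \<eta> n"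
      unfolding m_def using pos by (auto simp: Min_gr_iff)
    have "m \<le> \<epsilon> x"
      unfolding \<epsilon>_def
    proof (rule cINF_greatest)
      fix n
      show "m \<le> \<eta> n + infdist x (C n)"
      proof (cases "n < N")
        case True
        then show ?thesis using m(3) infdist_nonneg[of x "C n"] by (smt (verit))
      next
        case False
        then have "1 \<le> infdist x (C n)"
          unfolding infdist_notempty[OF ne]
          using N[of n] ne by (intro cINF_greatest) (auto simp: disjoint_iff not_less)
        then show ?thesis using m(2) pos[of n] by linarith
      qed
    qed simp
    then show ?thesis using m(1) by linarith
  qed
  moreover have "\<epsilon> x \<le> \<eta> n" if "x \<in> C n" for n x
    using cINF_lower[OF bdd[of x], of n] that unfolding \<epsilon>_def by simp
  ultimately show thesis using that[of \<epsilon>] cont unfolding pos_continuous_def by blast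
qed

text \<open>Prolonging the segment from \<open>x\<close> to \<open>y\<close> at both ends until it
  meets the frontier gives two frontier points at least as far apart as \<open>x\<close> and
  \<open>y\<close>.\<close>

lemma dist_le_of_frontier:
  fixes W :: "'a::euclidean_space set"
  assumes W: "open W" "bounded W" "x \<in> W" "y \<in> W"
    and d: "\<And>p q. p \<in> frontier W \<Longrightarrow> q \<in> frontier W \<Longrightarrow> dist p q \<le> d"
  shows "dist x y \<le> d"
proof (cases "x = y")
  case True
  \<comment> \<open>Only \<open>0 \<le> d\<close> is at stake here; any frontier point gives it, and
    one is found along an arbitrary direction.\<close>
  obtain b :: 'a where "b \<noteq> 0" using nonzero_Basis ex_in_conv[of "Basis :: 'a set"] by fastforce
  then obtain s where "x + s *\<^sub>R b \<in> frontier W"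
    using ray_to_frontier[OF W(2), of x b] W by (metis interior_open)
  then show ?thesis using d True by (metis dist_self)
next
  case False
  obtain s where s: "0 < s" "x + s *\<^sub>R (x - y) \<in> frontier W"
    using ray_to_frontier[OF W(2), of x "x - y"] W False by (metis interior_open right_minus_eq)
  obtain t where t: "0 < t" "y + t *\<^sub>R (y - x) \<in> frontier W"
    using ray_to_frontier[OF W(2), of y "y - x"] W False by (metis interior_open right_minus_eq)
  have "(x + s *\<^sub>R (x - y)) - (y + t *\<^sub>R (y - x)) = (1 + s + t) *\<^sub>R (x - y)"
    by (simp add: algebra_simps)
  then have "dist (x + s *\<^sub>R (x - y)) (y + t *\<^sub>R (y - x)) = (1 + s + t) * dist x y"
    using s t by (simp add: dist_norm)
  moreover have "dist x y \<le> (1 + s + t) * dist x y"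
    using s t mult_right_mono[of 1 "1 + s + t" "dist x y"] by simp
  ultimately show ?thesis using d[OF s(2) t(2)] by linarith
qed

section \<open>Dynamics of a homeomorphism attracting every compact set into
  \<open>U\<close>\<close>

locale ball_attracted =
  fixes f g :: "'a::euclidean_space \<Rightarrow> 'a" and U :: "'a set" and r :: real
  assumes hom: "homeomorphism UNIV UNIV f g"
    and openU: "open U"
    and f_U: "f ` U \<subseteq> U"
    and cover: "(\<Union>n. (f ^^ n) -` U) = UNIV"
    and r_pos: "0 < r"
    and U_ball: "U \<subseteq> ball 0 r"
begin

definition S :: "'a set" where "S = sphere 0 r"

text \<open>This bounded, forward invariant set is where the forward parts of pseudo orbits are
  kept, so that a positive continuous \<open>\<delta>\<close> has a positive lower bound along
  them.\<close>

definition V :: "'a set" where "V = (\<Union>n. (f ^^ n) ` S)"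

lemma gf: "g (f x) = x" and fg: "f (g x) = x"
  using hom by (auto simp: homeomorphism_def)

lemma inv_f: "inv f = g"
  by (rule inv_equality) (auto simp: gf fg)

lemma gf_pow: "(g ^^ n) ((f ^^ n) x) = x"
  by (induction n arbitrary: x) (auto simp: gf funpow_swap1)

lemma fg_pow: "(f ^^ n) ((g ^^ n) x) = x"
  by (induction n arbitrary: x) (auto simp: fg funpow_swap1)

lemma cont_f: "continuous_on A (f ^^ n)"
proof -
  have "continuous_on UNIV (f ^^ n)"
  proof (induction n)
    case (Suc n)
    then show ?case
      using hom continuous_on_compose[of UNIV "f ^^ n" f]
      by (auto simp: homeomorphism_def intro: continuous_on_subset)
  qed (auto simp: id_def)
  then show ?thesis by (rule continuous_on_subset) simp
qed

lemma cont_g: "continuous_on A (g ^^ n)"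
proof -
  have "continuous_on UNIV (g ^^ n)"
  proof (induction n)
    case (Suc n)
    then show ?case
      using hom continuous_on_compose[of UNIV "g ^^ n" g]
      by (auto simp: homeomorphism_def intro: continuous_on_subset)
  qed (auto simp: id_def)
  then show ?thesis by (rule continuous_on_subset) simp
qed

lemma hom_pow: "homeomorphism UNIV UNIV (f ^^ n) (g ^^ n)"
proof -
  have "surj (f ^^ n)" "surj (g ^^ n)" using fg_pow gf_pow by (metis surjI)+
  then show ?thesis by (auto simp: homeomorphism_def cont_f cont_g fg_pow gf_pow)
qed

lemma absorb:
  assumes "(f ^^ m) x \<in> U" "m \<le> n"
  shows "(f ^^ n) x \<in> U"
  using assms(2) by (induction rule: dec_induct) (use assms(1) f_U in auto)

text \<open>Finitely many of the open preimages of \<open>U\<close> cover \<open>C\<close>, and an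
  orbit that has entered \<open>U\<close> never leaves it, so the largest index serves all
  points.\<close>

lemma compact_absorbed:
  assumes "compact C"
  obtains N where "\<And>x n. x \<in> C \<Longrightarrow> N \<le> n \<Longrightarrow> (f ^^ n) x \<in> U"
proof -
  have "open ((f ^^ n) -` U)" for n
    using openU cont_f by (simp add: open_vimage)
  moreover have "C \<subseteq> (\<Union>n\<in>UNIV. (f ^^ n) -` U)" using cover by simp
  ultimately obtain I where I: "finite I" "C \<subseteq> (\<Union>n\<in>I. (f ^^ n) -` U)"
    using compactE_image[OF assms, of UNIV "\<lambda>n. (f ^^ n) -` U"] by (metis subset_UNIV)
  show thesis
  proof
    fix x n assume "x \<in> C" "Max (insert 0 I) \<le> n"
    then obtain m where "m \<in> I" "(f ^^ m) x \<in> U" using I by auto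
    moreover have "m \<le> n" using \<open>m \<in> I\<close> I \<open>Max (insert 0 I) \<le> n\<close> by (auto simp: Max_le_iff)
    ultimately show "(f ^^ n) x \<in> U" using absorb by blast
  qed
qed

lemma compact_S: "compact S" and S_ne: "S \<noteq> {}" and S_U: "S \<inter> U = {}"
  using r_pos U_ball by (auto simp: S_def)

text \<open>All but finitely many of the images of \<open>S\<close> lie in \<open>U\<close>.\<close>

lemma bounded_V: "bounded V"
proof -
  obtain N where N: "\<And>x n. x \<in> S \<Longrightarrow> N \<le> n \<Longrightarrow> (f ^^ n) x \<in> U"
    using compact_absorbed[OF compact_S] by blast
  have "V \<subseteq> (\<Union>n\<in>{..<N}. (f ^^ n) ` S) \<union> U"
    unfolding V_def using N by (force simp: not_less[symmetric])
  moreover have "bounded ((f ^^ n) ` S)" for n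
    using compact_S cont_f compact_continuous_image compact_imp_bounded by blast
  ultimately show ?thesis
    by (meson U_ball bounded_UN bounded_Un bounded_ball bounded_subset finite_lessThan)
qed

lemma f_V:
  assumes "x \<in> V"
  shows "(f ^^ n) x \<in> V"
proof -
  obtain m s where "s \<in> S" "x = (f ^^ m) s" using assms unfolding V_def by blast
  then have "(f ^^ n) x = (f ^^ (n + m)) s" by (simp add: funpow_add)
  then show ?thesis using \<open>s \<in> S\<close> unfolding V_def by blast
qed

lemma S_V: "S \<subseteq> V" and fS_V: "(f ^^ n) ` S \<subseteq> V"
  unfolding V_def using UN_upper[of 0 UNIV "\<lambda>n. (f ^^ n) ` S"] by auto

lemma backward_escape: "\<exists>N. \<forall>n\<ge>N. (g ^^ n) ` S \<inter> ball x 1 = {}"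
proof -
  obtain N where N: "\<And>y n. y \<in> cball x 1 \<Longrightarrow> N \<le> n \<Longrightarrow> (f ^^ n) y \<in> U"
    using compact_absorbed[OF compact_cball] by blast
  have "(g ^^ n) ` S \<inter> ball x 1 = {}" if "N \<le> n" for n
  proof (rule ccontr)
    assume "(g ^^ n) ` S \<inter> ball x 1 \<noteq> {}"
    then obtain s where "s \<in> S" "(g ^^ n) s \<in> ball x 1" by blast
    then have "s \<in> U" using N[of "(g ^^ n) s" n] that by (simp add: fg_pow)
    then show False using S_U \<open>s \<in> S\<close> by blast
  qed
  then show ?thesis by blast
qed

lemma rigid_tolerance:
  assumes "0 < e"
  obtains \<epsilon> where "\<epsilon> \<in> pos_continuous" "\<And>x. \<epsilon> x \<le> e"
    "\<And>y z. z \<in> S \<Longrightarrow> (\<And>n. n > 0 \<Longrightarrow> dist ((g ^^ n) y) ((g ^^ n) z) < \<epsilon> ((g ^^ n) z)) \<Longrightarrow> y = z"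
proof -
  have "\<exists>\<eta>>0. \<forall>x\<in>(g ^^ n) ` S. \<forall>y. dist y x < \<eta> \<longrightarrow> dist ((f ^^ n) y) ((f ^^ n) x) < 1 / Suc n" for n
  proof -
    have "compact ((g ^^ n) ` S)" using cont_g compact_S compact_continuous_image by blast
    then show ?thesis
      using uniform_modulus_compact[OF cont_f, of "(g ^^ n) ` S" "1 / Suc n" n] by (metis zero_less_divide_1_iff of_nat_0_less_iff zero_less_Suc)
  qed
  then obtain \<eta> where \<eta>: "\<And>n. 0 < \<eta> n"
    "\<And>n x y. x \<in> (g ^^ n) ` S \<Longrightarrow> dist y x < \<eta> n \<Longrightarrow> dist ((f ^^ n) y) ((f ^^ n) x) < 1 / Suc n"
    by metis
  obtain \<epsilon> where \<epsilon>: "\<epsilon> \<in> pos_continuous" "\<And>n x. x \<in> (g ^^ n) ` S \<Longrightarrow> \<epsilon> x \<le> \<eta> n"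
    using pos_continuous_locally_finite[of \<eta> "\<lambda>n. (g ^^ n) ` S"] \<eta>(1) S_ne backward_escape
    by (metis image_is_empty)
  show thesis
  proof
    show "(\<lambda>x. min e (\<epsilon> x)) \<in> pos_continuous"
      using \<epsilon>(1) assms unfolding pos_continuous_def by (auto intro!: continuous_intros)
    show "min e (\<epsilon> x) \<le> e" for x by simp
    fix y z assume z: "z \<in> S"
      and sh: "\<And>n. n > 0 \<Longrightarrow> dist ((g ^^ n) y) ((g ^^ n) z) < min e (\<epsilon> ((g ^^ n) z))"
    have close: "dist y z < 1 / Suc n" if "n > 0" for n
    proof -
      have "dist ((g ^^ n) y) ((g ^^ n) z) < \<eta> n"
        using sh[OF that] \<epsilon>(2)[of "(g ^^ n) z" n] z by fastforce
      then show ?thesis using \<eta>(2)[of "(g ^^ n) z" n "(g ^^ n) y"] z by (simp add: fg_pow)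
    qed
    show "y = z"
    proof (rule ccontr)
      assume "y \<noteq> z"
      then obtain n where n: "inverse (of_nat (Suc n)) < dist y z"
        using reals_Archimedean[of "dist y z"] by auto
      have "1 / real (Suc (Suc n)) \<le> inverse (real (Suc n))"
        by (simp add: divide_simps)
      then show False using n close[of "Suc n"] by linarith
    qed
  qed
qed

end

section \<open>Consequences of shadowing: stability, equicontinuity and drifting chains\<close>

locale ball_attracted_shadowing = ball_attracted +
  assumes shadowing: "topological_shadowing f"
begin

text \<open>Prefixing \<open>x\<close> with the exact backward orbit of \<open>z\<close> gives a
  pseudo orbit; by rigidity its shadowing point is \<open>z\<close>, so the forward orbit of
  \<open>z\<close> itself follows \<open>x\<close>.\<close>

lemma chain_stable:
  assumes "0 < e"
  obtains d where "0 < d"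
    "\<And>z x n. z \<in> S \<Longrightarrow> (\<And>i. x i \<in> V) \<Longrightarrow> dist z (x 0) < d \<Longrightarrow>
        (\<And>i. dist (f (x i)) (x (Suc i)) < d) \<Longrightarrow> dist ((f ^^ n) z) (x n) < e"
proof -
  obtain \<epsilon> where \<epsilon>: "\<epsilon> \<in> pos_continuous" "\<And>x. \<epsilon> x \<le> e"
    and rigid: "\<And>y z. z \<in> S \<Longrightarrow> (\<And>n. n > 0 \<Longrightarrow> dist ((g ^^ n) y) ((g ^^ n) z) < \<epsilon> ((g ^^ n) z)) \<Longrightarrow> y = z"
    using rigid_tolerance[OF assms] by metis
  obtain \<delta> where \<delta>: "\<delta> \<in> pos_continuous" "\<And>x. pseudo_orbit \<delta> f x \<Longrightarrow> \<exists>y. shadowed_by \<epsilon> f x y"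
    using shadowing \<epsilon>(1) unfolding topological_shadowing_def by blast
  have \<delta>_pos: "0 < \<delta> x" and \<delta>_cont: "continuous_on A \<delta>" for x A
    using \<delta>(1) by (auto simp: pos_continuous_def intro: continuous_on_subset)
  \<comment> \<open>The uniform jump size is the minimum of \<open>\<delta>\<close> over
    \<open>closure V\<close>, attained at \<open>v\<close>.\<close>
  have "compact (closure V)" "closure V \<noteq> {}"
    using bounded_V S_V S_ne by auto
  then obtain v where v: "\<And>x. x \<in> closure V \<Longrightarrow> \<delta> v \<le> \<delta> x"
    using continuous_attains_inf[OF _ _ \<delta>_cont] by blast
  show thesis
  proof
    show "0 < \<delta> v" by (rule \<delta>_pos)
    fix z x n
    assume z: "z \<in> S" and xV: "\<And>i. x i \<in> V" and x0: "dist z (x 0) < \<delta> v"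
      and step: "\<And>i. dist (f (x i)) (x (Suc i)) < \<delta> v"
    \<comment> \<open>Time 0 carries \<open>x 0\<close> rather than \<open>z\<close>, so the step
      from -1 to 0 is a jump from \<open>f (g z) = z\<close> to \<open>x 0\<close>.\<close>
    define X where "X i = (if i < 0 then (g ^^ nat (- i)) z else x (nat i))" for i :: int
    have "dist (f (X i)) (X (i + 1)) < \<delta> (f (X i))" for i
    proof -
      consider (neg) "i < -1" | (jump) "i = -1" | (pos) "0 \<le> i" by linarith
      then show ?thesis
      proof cases
        case neg
        then have "nat (- i) = Suc (nat (- (i + 1)))" by linarith
        then have "f (X i) = X (i + 1)" using neg by (simp add: X_def fg)
        then show ?thesis by (simp add: \<delta>_pos)
      next
        case jump
        have "z \<in> closure V" using z S_V closure_subset by blast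
        then show ?thesis using jump x0 v[of z] by (simp add: X_def fg)
      next
        case pos
        have "f (x (nat i)) \<in> closure V" using f_V[OF xV, of 1] closure_subset by fastforce
        moreover have "nat (i + 1) = Suc (nat i)" using pos by linarith
        ultimately show ?thesis using pos step[of "nat i"] v by (fastforce simp: X_def)
      qed
    qed
    then obtain y where y: "shadowed_by \<epsilon> f X y"
      using \<delta>(2)[of X] unfolding pseudo_orbit_def by blast
    \<comment> \<open>Only negative times see the orbit of \<open>z\<close>, hence the restriction
      to positive exponents in \<open>rigid\<close>.\<close>
    have "dist ((g ^^ k) y) ((g ^^ k) z) < \<epsilon> ((g ^^ k) z)" if "k > 0" for k
      using y[unfolded shadowed_by_def, rule_format, of "- int k"] that
      by (simp add: X_def int_iterate_def inv_f)
    then have "y = z" using rigid[OF z] by blast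
    then have "dist ((f ^^ n) z) (x n) < \<epsilon> (x n)"
      using y[unfolded shadowed_by_def, rule_format, of "int n"]
      by (simp add: X_def int_iterate_def)
    then show "dist ((f ^^ n) z) (x n) < e" using \<epsilon>(2) by (meson less_le_trans)
  qed
qed

text \<open>The orbit of \<open>b\<close> is a chain without errors, apart from the initial jump
  from \<open>a\<close> to \<open>b\<close>.\<close>

lemma equicontinuous_on_S:
  assumes "0 < e"
  obtains d where "0 < d" "\<And>a b n. a \<in> S \<Longrightarrow> b \<in> S \<Longrightarrow> dist a b < d \<Longrightarrow> dist ((f ^^ n) a) ((f ^^ n) b) < e"
proof -
  obtain d where d: "0 < d"
    "\<And>z x n. z \<in> S \<Longrightarrow> (\<And>i. x i \<in> V) \<Longrightarrow> dist z (x 0) < d \<Longrightarrow>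
        (\<And>i. dist (f (x i)) (x (Suc i)) < d) \<Longrightarrow> dist ((f ^^ n) z) (x n) < e"
    using chain_stable[OF assms] by metis
  show thesis
  proof
    fix a b n assume "a \<in> S" "b \<in> S" "dist a b < d"
    then show "dist ((f ^^ n) a) ((f ^^ n) b) < e"
      using d(1) S_V by (intro d(2)[of a "\<lambda>i. (f ^^ i) b"]) (auto intro!: f_V)
  qed (rule d(1))
qed

lemma almost_return:
  assumes "0 < e"
  obtains n N where "0 < N" "\<And>a. a \<in> (f ^^ n) ` S \<Longrightarrow> dist ((f ^^ N) a) a < e"
proof -
  obtain B where B: "\<And>x. x \<in> V \<Longrightarrow> norm x \<le> B" using bounded_V bounded_iff by metis
  have M: "norm ((f ^^ n) x) \<le> B" if "x \<in> S" for n x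
    using that fS_V B by blast
  have eq: "\<exists>d>0. \<forall>n y. y \<in> S \<and> norm (x - y) < d \<longrightarrow> norm ((f ^^ n) x - (f ^^ n) y) < e'"
    if x: "x \<in> S" and e': "0 < e'" for x e'
  proof -
    obtain d where "0 < d" "\<And>a b n. a \<in> S \<Longrightarrow> b \<in> S \<Longrightarrow> dist a b < d \<Longrightarrow> dist ((f ^^ n) a) ((f ^^ n) b) < e'"
      using equicontinuous_on_S[OF e'] by blast
    then show ?thesis using x by (intro exI[of _ d]) (auto simp: dist_norm)
  qed
  obtain h and k :: "nat \<Rightarrow> nat" where k: "strict_mono k"
    and h: "\<And>e'. 0 < e' \<Longrightarrow> \<exists>N. \<forall>n x. n \<ge> N \<and> x \<in> S \<longrightarrow> norm ((f ^^ (k n)) x - h x) < e'"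
    by (rule Arzela_Ascoli[OF compact_S, of "\<lambda>n. f ^^ n" B, OF M eq]) blast+
  obtain m where m: "\<And>n x. n \<ge> m \<Longrightarrow> x \<in> S \<Longrightarrow> dist ((f ^^ (k n)) x) (h x) < e / 2"
    using h[of "e / 2"] assms unfolding dist_norm by auto
  have lt: "k m < k (Suc m)" using k by (simp add: strict_mono_Suc_iff)
  show thesis
  proof
    show "0 < k (Suc m) - k m" using lt by simp
    fix a assume "a \<in> (f ^^ k m) ` S"
    then obtain s where s: "s \<in> S" "a = (f ^^ k m) s" by blast
    then have "(f ^^ (k (Suc m) - k m)) a = (f ^^ (k (Suc m) - k m + k m)) s"
      by (simp only: funpow_add comp_apply)
    then have "(f ^^ (k (Suc m) - k m)) a = (f ^^ k (Suc m)) s"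
      using lt by simp
    then show "dist ((f ^^ (k (Suc m) - k m)) a) a < e"
      using dist_triangle_half_l[OF m[of "Suc m" s] m[of m s]] s by simp
  qed
qed

text \<open>The witness is an infinite sequence, of which \<open>q\<close> is the entry at
  \<open>L\<close>, to match the premises of \<open>chain_stable\<close>.\<close>

definition chain :: "real \<Rightarrow> 'a \<Rightarrow> nat \<Rightarrow> 'a \<Rightarrow> bool" where
  "chain d z L q \<longleftrightarrow>
     (\<exists>x. x 0 = z \<and> (\<forall>i. x i \<in> V) \<and> (\<forall>i. dist (f (x i)) (x (Suc i)) < d) \<and> x L = q)"

lemma chain_orbit: "0 < d \<Longrightarrow> z \<in> V \<Longrightarrow> chain d z n ((f ^^ n) z)"
  unfolding chain_def by (rule exI[of _ "\<lambda>i. (f ^^ i) z"]) (auto intro: f_V)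

text \<open>The given sequence is cut off after position \<open>L\<close> and continued by the exact
  orbit of \<open>q'\<close>, which stays in \<open>V\<close>.\<close>

lemma chain_step:
  assumes "0 < d" "chain d z L q" "q' \<in> V" "dist (f q) q' < d"
  shows "chain d z (Suc L) q'"
proof -
  obtain x where x: "x 0 = z" "\<And>i. x i \<in> V" "\<And>i. dist (f (x i)) (x (Suc i)) < d" "x L = q"
    using assms(2) unfolding chain_def by blast
  define x' where "x' i = (if i \<le> L then x i else (f ^^ (i - Suc L)) q')" for i
  have "dist (f (x' i)) (x' (Suc i)) < d" for i
  proof -
    consider "i < L" | "i = L" | "L < i" by linarith
    then show ?thesis
    proof cases
      case 3
      then obtain j where "i = Suc (L + j)" using less_imp_Suc_add by blast
      then have "x' (Suc i) = f (x' i)" by (simp add: x'_def)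
      then show ?thesis using assms(1) by simp
    qed (use x assms in \<open>auto simp: x'_def\<close>)
  qed
  moreover have "x' i \<in> V" for i using x(2) f_V[OF assms(3)] by (simp add: x'_def)
  ultimately show ?thesis
    unfolding chain_def using x(1) by (intro exI[of _ x']) (auto simp: x'_def)
qed

lemma chain_V: "chain d z L q \<Longrightarrow> q \<in> V"
  unfolding chain_def by blast

lemma chain_funpow:
  assumes "0 < d" "chain d z L q"
  shows "chain d z (L + j) ((f ^^ j) q)"
proof (induction j)
  case (Suc j)
  then show ?case
    using chain_step[OF assms(1) Suc, of "f ((f ^^ j) q)"] f_V[OF chain_V[OF Suc], of 1] assms(1)
    by simp
qed (use assms in simp)

text \<open>The orbit of \<open>q\<close> is followed exactly for \<open>N - 1\<close> steps, and
  the whole error is made in the last one.\<close>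

lemma chain_jump:
  assumes "0 < d" "chain d z L q" "0 < N" "q' \<in> V" "dist ((f ^^ N) q) q' < d"
  shows "chain d z (L + N) q'"
proof -
  obtain j where j: "N = Suc j" using assms(3) gr0_conv_Suc by blast
  show ?thesis
    using chain_step[OF assms(1) chain_funpow[OF assms(1,2), of j] assms(4)] assms(5) j by simp
qed

text \<open>By almost return, chains can both stay at a point of \<open>f\<^sup>n(S)\<close> and drift to any other one in the
  same number of steps, and both ends stay near one orbit.\<close>

lemma small_image_of_sphere:
  assumes "connected S" "0 < e"
  obtains n where "\<And>a b. a \<in> (f ^^ n) ` S \<Longrightarrow> b \<in> (f ^^ n) ` S \<Longrightarrow> dist a b < e"
proof -
  obtain d where d: "0 < d"
    "\<And>z x n. z \<in> S \<Longrightarrow> (\<And>i. x i \<in> V) \<Longrightarrow> dist z (x 0) < d \<Longrightarrow>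
        (\<And>i. dist (f (x i)) (x (Suc i)) < d) \<Longrightarrow> dist ((f ^^ n) z) (x n) < e / 2"
    using chain_stable[of "e / 2"] assms(2) by (metis half_gt_zero)
  have stable: "dist ((f ^^ L) z) q < e / 2" if "z \<in> S" "chain d z L q" for z L q
    using that d unfolding chain_def by (metis dist_self)
  obtain n N where N: "0 < N" and ret: "\<And>a. a \<in> (f ^^ n) ` S \<Longrightarrow> dist ((f ^^ N) a) a < d / 2"
    using almost_return[of "d / 2"] d(1) by (metis half_gt_zero)
  have conn: "connected ((f ^^ n) ` S)"
    using assms(1) cont_f connected_continuous_image by blast
  show thesis
  proof
    fix a b assume a: "a \<in> (f ^^ n) ` S" and b: "b \<in> (f ^^ n) ` S"
    then obtain z where z: "z \<in> S" "a = (f ^^ n) z" by blast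
    \<comment> \<open>Half of \<open>d\<close> pays for the imperfect return under
      \<open>f ^^ N\<close>, the other half for the drift from \<open>q\<close> to
      \<open>q'\<close>.\<close>
    have jump: "chain d z (n + Suc k * N) q'"
      if "chain d z (n + k * N) q" "q \<in> (f ^^ n) ` S" "q' \<in> (f ^^ n) ` S" "dist q q' < d / 2" for k q q'
    proof -
      have "dist ((f ^^ N) q) q' < d"
        using ret[OF that(2)] that(4) dist_triangle[of "(f ^^ N) q" q' q] by linarith
      then show ?thesis
        using chain_jump[OF d(1) that(1) N, of q'] that(3) fS_V by (auto simp: ac_simps)
    qed
    have stay: "chain d z (n + k * N) a" for k
    proof (induction k)
      case 0
      then show ?case using chain_orbit[OF d(1)] z S_V by auto
    next
      case (Suc k)
      then show ?case using jump[OF Suc a a] d(1) by simp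
    qed
    \<comment> \<open>Being reached after some number of returns is a locally constant property on
      the connected image of \<open>S\<close>.\<close>
    have "\<exists>k. chain d z (n + k * N) b"
    proof (rule connected_induction_simple[OF conn a b, where P = "\<lambda>q. \<exists>k. chain d z (n + k * N) q"])
      show "\<exists>k. chain d z (n + k * N) a" using stay by blast
      fix c assume c: "c \<in> (f ^^ n) ` S"
      show "\<exists>T. openin (top_of_set ((f ^^ n) ` S)) T \<and> c \<in> T \<and>
        (\<forall>x\<in>T. \<forall>y\<in>T. (\<exists>k. chain d z (n + k * N) x) \<longrightarrow> (\<exists>k. chain d z (n + k * N) y))"
      \<comment> \<open>Two points of a ball of radius \<open>d / 4\<close> are less than
        \<open>d / 2\<close> apart, as \<open>jump\<close> requires.\<close>
      proof (intro exI[of _ "(f ^^ n) ` S \<inter> ball c (d / 4)"] conjI ballI impI)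
        show "openin (top_of_set ((f ^^ n) ` S)) ((f ^^ n) ` S \<inter> ball c (d / 4))"
          by (simp add: openin_open_Int)
        show "c \<in> (f ^^ n) ` S \<inter> ball c (d / 4)" using c d(1) by simp
        fix x y assume x: "x \<in> (f ^^ n) ` S \<inter> ball c (d / 4)" and y: "y \<in> (f ^^ n) ` S \<inter> ball c (d / 4)"
          and "\<exists>k. chain d z (n + k * N) x"
        then obtain k where k: "chain d z (n + k * N) x" by blast
        have "dist x y < d / 2"
          using x y dist_triangle_half_r[of c x "d / 2" y] by auto
        then show "\<exists>k. chain d z (n + k * N) y" using jump[OF k, of y] x y by blast
      qed
    qed
    then obtain k where "chain d z (n + k * N) b" by blast
    \<comment> \<open>The chains ending at \<open>a\<close> and at \<open>b\<close> have the same
      length and the same start \<open>z\<close>, so both ends are within \<open>e / 2\<close> of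
      \<open>(f ^^ (n + k * N)) z\<close>.\<close>
    then show "dist a b < e"
      using stable[OF z(1) stay[of k]] stable[OF z(1)] dist_triangle_half_r by blast
  qed
qed

text \<open>The dimension bound makes \<open>S\<close> connected. The image of the ball around
  \<open>U\<close> is a bounded open set whose frontier lies in the small image of \<open>S\<close>,
  hence it is small too.\<close>

lemma small_image_of_U:
  assumes "2 \<le> DIM('a)" "0 < e"
  obtains n where "\<And>a b. a \<in> (f ^^ n) ` U \<Longrightarrow> b \<in> (f ^^ n) ` U \<Longrightarrow> dist a b \<le> e"
proof -
  have "connected S" unfolding S_def using connected_sphere[OF assms(1)] .
  then obtain n where n: "\<And>a b. a \<in> (f ^^ n) ` S \<Longrightarrow> b \<in> (f ^^ n) ` S \<Longrightarrow> dist a b < e"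
    using small_image_of_sphere assms(2) by metis
  define W where "W = (f ^^ n) ` ball 0 r"
  have "open W"
    using homeomorphism_imp_open_map[OF hom_pow, of "ball 0 r" n] unfolding W_def by simp
  have comp: "compact ((f ^^ n) ` cball 0 r)"
    using cont_f compact_continuous_image compact_cball by blast
  have sub: "W \<subseteq> (f ^^ n) ` cball 0 r" unfolding W_def by auto
  then have "bounded W" using comp compact_imp_bounded bounded_subset by blast
  have "frontier W \<subseteq> (f ^^ n) ` S"
  proof -
    have "closure W \<subseteq> (f ^^ n) ` cball 0 r"
      using comp sub closure_minimal compact_imp_closed by blast
    then have "frontier W \<subseteq> (f ^^ n) ` cball 0 r - W"
      using \<open>open W\<close> by (auto simp: frontier_def interior_open)
    then show ?thesis unfolding W_def S_def by (force simp: dist_norm)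
  qed
  then have "dist x y \<le> e" if "x \<in> W" "y \<in> W" for x y
    using dist_le_of_frontier[OF \<open>open W\<close> \<open>bounded W\<close> that, of e] n by (meson less_imp_le subsetD)
  then show thesis using that[of n] U_ball unfolding W_def by blast
qed

end

section \<open>The attractor and its triviality\<close>

lemma attracting_nbhdD:
  assumes "attracting_nbhd f K U"
  shows "open U" "bounded U" "K \<subseteq> U" "closure (f ` U) \<subseteq> U" "K = (\<Inter>n\<in>{0<..}. (f ^^ n) ` U)"
  using assms[unfolded attracting_nbhd_def] by - (elim conjE, assumption)+

lemma attractor_nonempty:
  fixes f :: "'a::heine_borel \<Rightarrow> 'a"
  assumes cont: "continuous_on UNIV f" and att: "attracting_nbhd f K U" and ne: "U \<noteq> {}"
  shows "K \<noteq> {}"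
proof -
  note bd = attracting_nbhdD(2)[OF att] and cl = attracting_nbhdD(4)[OF att]
    and K = attracting_nbhdD(5)[OF att]
  define F where "F n = (f ^^ n) ` closure (f ` U)" for n
  have "bounded (f ` U)" 
    using bounded_subset[OF bd order_trans[OF closure_subset cl]] .
  then have F0: "compact (closure (f ` U))" by simp
  have F_Suc: "F (Suc n) = f ` F n" for n by (auto simp: F_def)
  have "compact (F n)" for n
  proof (induction n)
    case 0
    then show ?case using F0 by (simp add: F_def)
  next
    case (Suc n)
    then show ?case
      unfolding F_Suc using cont compact_continuous_image continuous_on_subset by blast
  qed
  moreover have "F n \<noteq> {}" for n using ne by (simp add: F_def)
  moreover have "F (Suc n) \<subseteq> F n" for n
  proof -
    have "f ` closure (f ` U) \<subseteq> closure (f ` U)" 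
      using order_trans[OF image_mono[OF cl] closure_subset] .
    then show ?thesis unfolding F_def funpow_Suc_right image_comp[symmetric] by (rule image_mono)
  qed
  then have "F n \<subseteq> F m" if "m \<le> n" for m n
    using that by (rule lift_Suc_antimono_le[of F])
  ultimately have "\<Inter>(range F) \<noteq> {}" by (intro compact_nest)
  moreover have "\<Inter>(range F) \<subseteq> K" 
    unfolding K F_def by (rule INT_anti_mono) (simp_all only: subset_UNIV image_mono[OF cl])
  ultimately show ?thesis by blast
qed

theorem theorem1:
  fixes f :: "real ^ 'm \<Rightarrow> real ^ 'm" and K :: "(real ^ 'm) set"
  assumes "CARD('m) \<ge> 2"
    and "\<exists>g. homeomorphism UNIV UNIV f g"
    and "topological_shadowing f"
    and "compact K"
    and "global_attractor f K"
  shows "\<exists>p. K = {p}"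
proof -
  obtain g where g: "homeomorphism UNIV UNIV f g" using assms(2) by blast
  obtain U where U: "attracting_nbhd f K U" "(\<Union>n. (f ^^ n) -` U) = UNIV"
    using assms(5) unfolding global_attractor_def by blast
  obtain r where r: "0 < r" "U \<subseteq> ball 0 r"
    using bounded_subset_ballD[OF attracting_nbhdD(2)[OF U(1)]] by blast
  interpret ball_attracted_shadowing f g U r
  proof
    show "f ` U \<subseteq> U" "open U"
      using attracting_nbhdD(1,4)[OF U(1)] closure_subset[of "f ` U"] by blast+
  qed (fact g U(2) r assms(3))+
  have "U \<noteq> {}" using U(2) by auto
  then have "K \<noteq> {}"
    using attractor_nonempty[OF _ U(1)] g by (simp add: homeomorphism_def)
  then obtain p where p: "p \<in> K" by blast
  \<comment> \<open>The intersection defining \<open>K\<close> starts at 1, but the \<open>n\<close>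
    supplied by \<open>small_image_of_U\<close> may be 0; then \<open>K \<subseteq> U\<close> is
    used.\<close>
  have KU: "K \<subseteq> (f ^^ n) ` U" for n
  proof (cases "n = 0")
    case True
    then show ?thesis using attracting_nbhdD(3)[OF U(1)] by simp
  next
    case False
    then show ?thesis unfolding attracting_nbhdD(5)[OF U(1)] by (intro INF_lower) simp
  qed
  have "q = p" if "q \<in> K" for q
  proof (rule ccontr)
    assume "q \<noteq> p"
    then have "0 < dist q p / 2" by simp
    then obtain n where
      n: "\<And>a b. a \<in> (f ^^ n) ` U \<Longrightarrow> b \<in> (f ^^ n) ` U \<Longrightarrow> dist a b \<le> dist q p / 2"
      using small_image_of_U assms(1) by (metis DIM_cart DIM_real mult.right_neutral)
    have "q \<in> (f ^^ n) ` U" "p \<in> (f ^^ n) ` U" using KU that p by blast+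
    then show False using n[of q p] \<open>0 < dist q p / 2\<close> by linarith
  qed
  then show ?thesis using p by blast
qed

end
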